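(* Let $f:\mathbb{R}^n\times\mathbb{R}^m\to\mathbb{R}^n$ and $h:\mathbb{R}^n\to\mathbb{R}^p$ be smooth and consider the system $\dot x=f(x,u)$, $y=h(x)$. Let $n_\xi\ge n-p$, $0\le q\le n_\xi$, let $\lambda_1,\dots,\lambda_q<0$, and set $$\Lambda_L:=\mathrm{diag}\{\lambda_1,\dots,\lambda_q\},\qquad \Lambda:=\begin{bmatrix}\Lambda_L & 0\\ 0& 0\end{bmatrix}\in\mathbb{R}^{n_\xi\times n_\xi}.$$ Assume there exist smooth mappings $\phi:\mathbb{R}^n\to\mathbb{R}^{n_\xi}$, $\phi^{\mathtt L}:\mathbb{R}^{n_\xi}\times\mathbb{R}^p\to\mathbb{R}^n$ and $B:\mathbb{R}^p\times\mathbb{R}^m\to\mathbb{R}^{n_\xi}$ such that (i) $\nabla\phi^\top(x)f(x,u)=\Lambda\phi(x)+B(h(x),u)$ for all $x\in\mathbb{R}^n$, $u\in\mathbb{R}^m$; (ii) $\phi^{\mathtt L}(\phi(x),h(x))=x$ for all $x\in\mathbb{R}^n$. Partition $B=\mathrm{col}(B_L,B_P)$ and $\phi=\mathrm{col}(\phi_L,\phi_P)$ with $B_L,\phi_L$ taking values in $\mathbb{R}^q$ and $B_P,\phi_P$ taking values in $\mathbb{R}^{n_\xi-q}$. Let $M_P:\mathbb{R}^{n_\zeta}\times\mathbb{R}^{n_\xi-q}\times\mathbb{R}^p\times\mathbb{R}^m\to\mathbb{R}^{n_\zeta}$ and $N_P:\mathbb{R}^{n_\zeta}\times\mathbb{R}^{n_\xi-q}\times\mathbb{R}^p\times\mathbb{R}^m\to\mathbb{R}^{n_\xi-q}$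 be smooth mappings, and consider the observer $$\begin{aligned} \dot\xi_L&=\Lambda_L\xi_L+B_L(y,u),\\ \dot\xi_P&=B_P(y,u),\\ \dot\zeta&=M_P(\zeta,\xi_P,y,u),\\ \hat\theta&=N_P(\zeta,\xi_P,y,u),\\ \hat x&=\phi^{\mathtt L}\left(\begin{bmatrix}\xi_L\\ \xi_P\end{bmatrix}+\begin{bmatrix}\mathbf{0}_q\\ \hat\theta\end{bmatrix},\,y\right). \end{aligned}$$ Suppose $M_P,N_P$ define a consistent estimator, i.e. $\lim_{t\to\infty}|\hat\theta(t)-\theta|=0$, where $\theta:=\phi_P(x(0))-\xi_P(0)$. Then $$\lim_{t\to\infty}|\hat x(t)-x(t)|=0.$$
   Context: Here $x(t)\in\mathbb{R}^n$ is the state, $u(t)\in\mathbb{R}^m$ the input and $y(t)\in\mathbb{R}^p$ the measured output; $|\cdot|$ is the Euclidean norm. $\nabla:=(\partial/\partial x)^\top$, so $\nabla\phi^\top(x)$ is the Jacobian matrix of $\phi$ at $x$. $\mathbf{0}_q$ is the zero vector of $\mathbb{R}^q$, and $\mathrm{col}(\cdot,\cdot)$ denotes stacking into a column vector. Standing assumptions: all mappings are smooth; the input $u$ is such that the state trajectories of the system are bounded; all solutions considered (of the system and of the observer) are defined for all $t\ge 0$. *)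

theory Defs
  imports "HOL-Analysis.Analysis"
begin

text \<open>
  Maps of class \<open>C\<^sup>k\<close> and \<open>C\<^sup>\<infinity>\<close> on a whole Euclidean space: the derivative is differentiated again
  through its directional derivatives. A map of several arguments is a map on the product space,
  so smoothness is always joint smoothness.
\<close>

primrec Ck_map :: "nat \<Rightarrow> ('a::euclidean_space \<Rightarrow> 'b::euclidean_space) \<Rightarrow> bool" where
  "Ck_map 0 f \<longleftrightarrow> continuous_on UNIV f"
| "Ck_map (Suc k) f \<longleftrightarrow>
     (\<forall>x. f differentiable (at x)) \<and> (\<forall>v. Ck_map k (\<lambda>x. frechet_derivative f (at x) v))"

definition smooth_map :: "('a::euclidean_space \<Rightarrow> 'b::euclidean_space) \<Rightarrow> bool" where
  "smooth_map f \<longleftrightarrow> (\<forall>k. Ck_map k f)"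

text \<open>
  Splitting \<open>\<real>\<^sup>d = \<real>\<^sup>q \<times> \<real>\<^sup>d\<^sup>-\<^sup>q\<close> with \<open>0 \<le> q \<le> d\<close>. Index types are never empty, so typed blocks
  would exclude \<open>q = 0\<close> and \<open>q = d\<close>. Instead, \<open>\<real>\<^sup>q\<close> and \<open>\<real>\<^sup>d\<^sup>-\<^sup>q\<close> are identified with the coordinate
  subspaces \<open>\<real>\<^sup>q \<times> {0}\<close> and \<open>{0} \<times> \<real>\<^sup>d\<^sup>-\<^sup>q\<close> of \<open>real ^ 'k\<close>, where \<open>d = CARD('k)\<close>.
  Under this identification \<open>col(a, b)\<close> is \<open>a + b\<close>, and the norms agree.
  A map with an argument in \<open>\<real>\<^sup>d\<^sup>-\<^sup>q\<close> is represented by a map on all of \<open>real ^ 'k\<close>, to be evaluated on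
  \<open>tail_space q\<close> only; composing with \<open>tail_part q\<close> extends every smooth map on the subspace this way.
  The linear order on the index type enumerates the coordinates as \<open>1, \<dots>, d\<close>.
\<close>

definition coord_no :: "'k::{finite,linorder} \<Rightarrow> nat" where
  "coord_no i = card {..i}"

lemma coord_no_bij: "bij_betw coord_no (UNIV :: 'k::{finite,linorder} set) {1..CARD('k)}"
proof -
  have less: "coord_no i < coord_no j" if "i < j" for i j :: 'k
    unfolding coord_no_def using that by (intro psubset_card_mono) auto
  have inj: "inj (coord_no :: 'k \<Rightarrow> nat)"
    by (rule injI) (metis less less_irrefl linorder_neqE)
  have sub: "range (coord_no :: 'k \<Rightarrow> nat) \<subseteq> {1..CARD('k)}"
    by (auto simp: coord_no_def Suc_le_eq card_gt_0_iff intro!: card_mono[OF finite subset_UNIV])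
  have "range (coord_no :: 'k \<Rightarrow> nat) = {1..CARD('k)}"
    by (rule card_subset_eq) (use sub inj in \<open>auto simp: card_image\<close>)
  with inj show ?thesis by (simp add: bij_betw_def)
qed

definition head_space :: "nat \<Rightarrow> (real ^ 'k::{finite,linorder}) set" where
  "head_space q = {v. \<forall>i. coord_no i > q \<longrightarrow> v $ i = 0}"

definition tail_space :: "nat \<Rightarrow> (real ^ 'k::{finite,linorder}) set" where
  "tail_space q = {v. \<forall>i. coord_no i \<le> q \<longrightarrow> v $ i = 0}"

definition head_part :: "nat \<Rightarrow> real ^ 'k::{finite,linorder} \<Rightarrow> real ^ 'k::{finite,linorder}" where
  "head_part q v = (\<chi> i. if coord_no i \<le> q then v $ i else 0)"

definition tail_part :: "nat \<Rightarrow> real ^ 'k::{finite,linorder} \<Rightarrow> real ^ 'k::{finite,linorder}" where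
  "tail_part q v = (\<chi> i. if coord_no i \<le> q then 0 else v $ i)"

text \<open>
  The block matrix with upper left block \<open>diag(\<lambda>\<^sub>1, \<dots>, \<lambda>\<^sub>q)\<close> and all other blocks zero. It maps
  \<open>head_space q\<close> to itself and acts there as \<open>diag(\<lambda>\<^sub>1, \<dots>, \<lambda>\<^sub>q)\<close> acts on \<open>\<real>\<^sup>q\<close>.
\<close>

definition block_diag :: "nat \<Rightarrow> (nat \<Rightarrow> real) \<Rightarrow> real ^ 'k::{finite,linorder} ^ 'k::{finite,linorder}" where
  "block_diag q lam = (\<chi> i j. if i = j \<and> coord_no i \<le> q then lam (coord_no i) else 0)"

end

theory Submission
  imports Defs
begin

text \<open>
  The error \<open>\<phi>(x) - (\<xi>\<^sub>L + \<xi>\<^sub>P)\<close> satisfies the autonomous linear equation \<open>e' = \<Lambda>e\<close>: its first \<open>q\<close>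
  coordinates decay exponentially and the remaining ones are constantly equal to \<open>\<theta>\<close>. Hence the
  first argument of \<open>\<phi>\<^sup>L\<close> in the observer approaches \<open>\<phi>(x)\<close>. Since \<open>x\<close> is bounded, \<open>(\<phi>(x), h(x))\<close>
  stays in a compact set, near which \<open>\<phi>\<^sup>L\<close> is uniformly continuous, so \<open>\<phi>\<^sup>L\<close> preserves this.
\<close>

lemma smooth_map_differentiable: "smooth_map f \<Longrightarrow> f differentiable (at x)"
  unfolding smooth_map_def by (metis Ck_map.simps(2))

lemma smooth_map_continuous_on: "smooth_map f \<Longrightarrow> continuous_on S f"
  by (metis smooth_map_def Ck_map.simps(1) continuous_on_subset subset_UNIV)

lemma block_diag_mult_nth:
  "(block_diag q lam *v v) $ i = (if coord_no i \<le> q then lam (coord_no i) else 0) * v $ i"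
  by (simp add: block_diag_def matrix_vector_mult_def if_distrib[of "\<lambda>a. a * _"] cong: if_cong)

lemma head_part_add_tail_part: "head_part q v + tail_part q v = v"
  by (simp add: head_part_def tail_part_def vec_eq_iff)

text \<open>The integrating factor \<open>exp (- c * t)\<close> turns \<open>e\<close> into a
  function with zero derivative on the half-line. Convexity of \<open>{0..}\<close> makes this
  function constant, and its value is read off at 0.\<close>

lemma linear_ode_solution:
  fixes e :: "real \<Rightarrow> real"
  assumes "\<And>t. t \<ge> 0 \<Longrightarrow> (e has_real_derivative c * e t) (at t within {0..})" and "t \<ge> 0"
  shows "e t = e 0 * exp (c * t)"
proof -
  have "((\<lambda>t. e t * exp (- c * t)) has_real_derivative 0) (at t within {0..})"
    if "t \<in> {0..}" for t
    using that by (auto intro!: derivative_eq_intros assms(1))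
  then obtain k where k: "\<And>t. t \<in> {0..} \<Longrightarrow> e t * exp (- c * t) = k"
    using has_field_derivative_zero_constant[OF convex_real_interval(1),
        of 0 "\<lambda>t. e t * exp (- c * t)"] by metis
  have "e t * exp (- c * t) = e 0"
    using k[of t] k[of 0] \<open>t \<ge> 0\<close> by simp
  then show ?thesis
    by (simp add: exp_minus field_simps)
qed

text \<open>Neither \<open>a\<close> nor \<open>b\<close> has to converge, so continuity at a limit
  point is of no help; uniform continuity on a compact set replaces it. Only \<open>a\<close> is
  known to stay in \<open>K\<close>, hence \<open>K\<close> is thickened by the closed unit ball to
  capture \<open>b\<close> as well.\<close>

lemma tendsto_diff_continuous_image:
  fixes g :: "'a::euclidean_space \<Rightarrow> 'b::real_normed_vector"
  assumes cont: "continuous_on UNIV g" and K: "compact K" "\<forall>\<^sub>F t in F. a t \<in> K"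
    and lim: "((\<lambda>t. b t - a t) \<longlongrightarrow> 0) F"
  shows "((\<lambda>t. g (b t) - g (a t)) \<longlongrightarrow> 0) F"
proof (rule tendstoI)
  fix r :: real
  assume "r > 0"
  let ?K = "(\<Union>v\<in>K. \<Union>w\<in>cball 0 1. {v + w})"
  have K': "compact ?K"
    using compact_sums'[OF \<open>compact K\<close> compact_cball] .
  have "uniformly_continuous_on ?K g"
    using compact_uniformly_continuous[OF continuous_on_subset[OF cont] K'] by simp
  then obtain d where "d > 0"
    and d: "\<And>v w. \<lbrakk>v \<in> ?K; w \<in> ?K; dist w v < d\<rbrakk> \<Longrightarrow> dist (g w) (g v) < r"
    unfolding uniformly_continuous_on_def using \<open>r > 0\<close> by metis
  \<comment> \<open>The bound 1 keeps \<open>b t\<close> inside the thickened set, the bound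
    \<open>d\<close> serves uniform continuity.\<close>
  have "\<forall>\<^sub>F t in F. dist (b t - a t) 0 < min d 1"
    using lim \<open>d > 0\<close> by (intro tendstoD) auto
  with K(2) show "\<forall>\<^sub>F t in F. dist (g (b t) - g (a t)) 0 < r"
  proof eventually_elim
    case (elim t)
    have "a t \<in> ?K"
      using elim(1) by (intro UN_I[of "a t"] UN_I[of 0]) auto
    moreover have "b t \<in> ?K"
      using elim by (intro UN_I[of "a t"] UN_I[of "b t - a t"]) auto
    ultimately show ?case
      using d[of "a t" "b t"] elim(2) by (simp add: dist_norm)
  qed
qed

theorem proposition3:
  fixes f :: "(real ^ 'n) \<times> (real ^ 'm) \<Rightarrow> real ^ 'n"
    and h :: "real ^ 'n \<Rightarrow> real ^ 'p"
    and q :: nat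
    and lam :: "nat \<Rightarrow> real"
    and Lambda :: "real ^ 'k::{finite,linorder} ^ 'k::{finite,linorder}"
    and phi :: "real ^ 'n \<Rightarrow> real ^ 'k::{finite,linorder}"
    and phi_linv :: "(real ^ 'k::{finite,linorder}) \<times> (real ^ 'p) \<Rightarrow> real ^ 'n"
    and B :: "(real ^ 'p) \<times> (real ^ 'm) \<Rightarrow> real ^ 'k::{finite,linorder}"
    and M\<^sub>P :: "(real ^ 'z) \<times> (real ^ 'k::{finite,linorder}) \<times> (real ^ 'p) \<times> (real ^ 'm) \<Rightarrow> real ^ 'z"
    and N\<^sub>P :: "(real ^ 'z) \<times> (real ^ 'k::{finite,linorder}) \<times> (real ^ 'p) \<times> (real ^ 'm) \<Rightarrow> real ^ 'k::{finite,linorder}"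
    and u :: "real \<Rightarrow> real ^ 'm"
    and x xhat :: "real \<Rightarrow> real ^ 'n"
    and y :: "real \<Rightarrow> real ^ 'p"
    and xi\<^sub>L xi\<^sub>P thetahat :: "real \<Rightarrow> real ^ 'k::{finite,linorder}"
    and zeta :: "real \<Rightarrow> real ^ 'z"
    and theta :: "real ^ 'k::{finite,linorder}"
  assumes dim: "CARD('k) + CARD('p) \<ge> CARD('n)"
    and q: "q \<le> CARD('k)"
    and lam: "\<And>i. i \<in> {1..q} \<Longrightarrow> lam i < 0"
    and Lambda: "Lambda = block_diag q lam"
    and smooth: "smooth_map f" "smooth_map h" "smooth_map phi" "smooth_map phi_linv" "smooth_map B"
      "smooth_map M\<^sub>P" "smooth_map N\<^sub>P"
    and immersion: "\<And>x u. jacobian phi (at x) *v f (x, u) = Lambda *v phi x + B (h x, u)"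
    and left_inverse: "\<And>x. phi_linv (phi x, h x) = x"
    and N_codomain: "range N\<^sub>P \<subseteq> tail_space q"
    and system: "\<And>t. t \<ge> 0 \<Longrightarrow> (x has_vector_derivative f (x t, u t)) (at t within {0..})"
    and measurement: "\<And>t. t \<ge> 0 \<Longrightarrow> y t = h (x t)"
    and bounded: "bounded (x ` {0..})"
    and xi_spaces: "\<And>t. t \<ge> 0 \<Longrightarrow> xi\<^sub>L t \<in> head_space q" "\<And>t. t \<ge> 0 \<Longrightarrow> xi\<^sub>P t \<in> tail_space q"
    and observer_L: "\<And>t. t \<ge> 0 \<Longrightarrow>
      (xi\<^sub>L has_vector_derivative (Lambda *v xi\<^sub>L t + head_part q (B (y t, u t)))) (at t within {0..})"
    and observer_P: "\<And>t. t \<ge> 0 \<Longrightarrow>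
      (xi\<^sub>P has_vector_derivative tail_part q (B (y t, u t))) (at t within {0..})"
    and observer_zeta: "\<And>t. t \<ge> 0 \<Longrightarrow>
      (zeta has_vector_derivative M\<^sub>P (zeta t, xi\<^sub>P t, y t, u t)) (at t within {0..})"
    and observer_theta: "\<And>t. t \<ge> 0 \<Longrightarrow> thetahat t = N\<^sub>P (zeta t, xi\<^sub>P t, y t, u t)"
    and observer_x: "\<And>t. t \<ge> 0 \<Longrightarrow> xhat t = phi_linv ((xi\<^sub>L t + xi\<^sub>P t) + thetahat t, y t)"
    and theta: "theta = tail_part q (phi (x 0)) - xi\<^sub>P 0"
    and consistent: "((\<lambda>t. norm (thetahat t - theta)) \<longlongrightarrow> 0) at_top"
  shows "((\<lambda>t. norm (xhat t - x t)) \<longlongrightarrow> 0) at_top"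
proof -
  define e where "e t = phi (x t) - (xi\<^sub>L t + xi\<^sub>P t)" for t
  \<comment> \<open>These are the diagonal entries of \<open>Lambda\<close>, so the error equation
    decouples into scalar equations with rates \<open>r i\<close>.\<close>
  define r where "r i = (if coord_no i \<le> q then lam (coord_no i) else 0)" for i :: 'k
  have e_deriv: "(e has_vector_derivative Lambda *v e t) (at t within {0..})" if "t \<ge> 0" for t
  proof -
    have "(phi has_derivative (*v) (jacobian phi (at (x t)))) (at (x t) within x ` {0..})"
      using smooth_map_differentiable[OF smooth(3)] jacobian_works has_derivative_at_withinI
      by blast
    from vector_derivative_diff_chain_within[OF system[OF that] this]
    have "((\<lambda>t. phi (x t)) has_vector_derivative Lambda *v phi (x t) + B (y t, u t))
        (at t within {0..})"
      using that by (simp add: o_def immersion measurement)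
    from has_vector_derivative_diff[OF this
        has_vector_derivative_add[OF observer_L[OF that] observer_P[OF that]]]
    have *: "(e has_vector_derivative Lambda *v phi (x t) + B (y t, u t) -
        (Lambda *v xi\<^sub>L t + head_part q (B (y t, u t)) + tail_part q (B (y t, u t))))
        (at t within {0..})"
      by (simp add: e_def[abs_def])
    \<comment> \<open>The equation for \<open>xi\<^sub>P\<close> has no linear term. It still fits
      \<open>e' = Lambda e\<close> because \<open>Lambda\<close> annihilates the tail space.\<close>
    have "Lambda *v xi\<^sub>P t = 0"
      using xi_spaces(2)[OF that]
      by (auto simp: vec_eq_iff Lambda block_diag_mult_nth tail_space_def)
    then have "Lambda *v phi (x t) + B (y t, u t) -
        (Lambda *v xi\<^sub>L t + head_part q (B (y t, u t)) + tail_part q (B (y t, u t))) = Lambda *v e t"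
      by (simp add: e_def matrix_vector_mult_diff_distrib matrix_vector_right_distrib
          add.assoc head_part_add_tail_part)
    with * show ?thesis by simp
  qed
  have e_nth: "e t $ i = e 0 $ i * exp (r i * t)" if "t \<ge> 0" for t i
  proof (rule linear_ode_solution[OF _ that])
    fix s :: real
    assume "s \<ge> 0"
    from bounded_linear.has_vector_derivative[OF bounded_linear_vec_nth e_deriv[OF this], of i]
    show "((\<lambda>t. e t $ i) has_real_derivative r i * e s $ i) (at s within {0..})"
      by (simp add: has_real_derivative_iff_has_vector_derivative Lambda block_diag_mult_nth r_def)
  qed
  have e_lim: "((\<lambda>t. e t $ i) \<longlongrightarrow> theta $ i) at_top" for i
  proof (cases "coord_no i \<le> q")
    case True
    \<comment> \<open>Coordinates are numbered from 1, so the sign condition on \<open>lam\<close>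
      covers every head coordinate.\<close>
    have "coord_no i \<ge> 1"
      using bij_betwE[OF coord_no_bij] by auto
    then have "r i < 0"
      using True lam by (simp add: r_def)
    then have "filterlim (\<lambda>t. r i * t) at_bot at_top"
      by (intro filterlim_tendsto_neg_mult_at_bot[OF tendsto_const] filterlim_ident)
    then have "((\<lambda>t. e 0 $ i * exp (r i * t)) \<longlongrightarrow> 0) at_top"
      by (intro tendsto_mult_right_zero filterlim_compose[OF exp_at_bot])
    \<comment> \<open>\<open>theta\<close> lies in the tail space, so on head coordinates decay to 0
      is convergence to \<open>theta\<close>.\<close>
    moreover have "theta $ i = 0"
      using True xi_spaces(2)[of 0] by (simp add: theta tail_part_def tail_space_def)
    moreover have "\<forall>\<^sub>F t in at_top. e 0 $ i * exp (r i * t) = e t $ i"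
      using eventually_ge_at_top[of 0] by eventually_elim (rule e_nth[symmetric])
    ultimately show ?thesis
      using Lim_transform_eventually[of _ 0 at_top "\<lambda>t. e t $ i"] by simp
  next
    case False
    have "\<forall>\<^sub>F t in at_top. theta $ i = e t $ i"
      using eventually_ge_at_top[of 0]
    proof eventually_elim
      case (elim t)
      \<comment> \<open>On a tail coordinate \<open>xi\<^sub>L 0\<close> vanishes, which leaves the
        definition of \<open>theta\<close>; as \<open>r i = 0\<close>, this initial value
        persists.\<close>
      have "e 0 $ i = theta $ i"
        using False xi_spaces(1)[of 0] by (simp add: e_def theta tail_part_def head_space_def)
      with False elim show ?case by (simp add: e_nth[of t] r_def)
    qed
    then show ?thesis
      by (rule tendsto_eventually[OF eventually_mono]) simp
  qed
  define a where "a t = (phi (x t), h (x t))" for t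
  \<comment> \<open>With \<open>h (x t)\<close> in place of \<open>y t\<close>, which agrees with it
    only for \<open>t \<ge> 0\<close>, the second component of \<open>b t - a t\<close> is 0 for
    every \<open>t\<close>; the first is \<open>thetahat t - e t\<close>.\<close>
  define b where "b t = (xi\<^sub>L t + xi\<^sub>P t + thetahat t, h (x t))" for t
  have "(e \<longlongrightarrow> theta) at_top"
    by (rule vec_tendstoI) (rule e_lim)
  moreover have "((\<lambda>t. thetahat t - theta) \<longlongrightarrow> 0) at_top"
    using consistent by (simp add: tendsto_norm_zero_iff)
  ultimately have "((\<lambda>t. (thetahat t - theta) - (e t - theta)) \<longlongrightarrow> 0 - (theta - theta)) at_top"
    by (intro tendsto_intros)
  then have "((\<lambda>t. (thetahat t - e t, 0)) \<longlongrightarrow> (0, 0)) at_top"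
    by (intro tendsto_Pair) simp_all
  then have lim: "((\<lambda>t. b t - a t) \<longlongrightarrow> 0) at_top"
    by (simp add: a_def b_def e_def zero_prod_def algebra_simps)
  \<comment> \<open>Boundedness of the trajectory enters here: its closure is compact, and so is the
    continuous image.\<close>
  let ?K = "(\<lambda>v. (phi v, h v)) ` closure (x ` {0..})"
  have "compact ?K"
    using bounded smooth by (intro compact_continuous_image continuous_on_Pair)
      (auto intro: smooth_map_continuous_on)
  moreover have "\<forall>\<^sub>F t in at_top. a t \<in> ?K"
    using eventually_ge_at_top[of 0]
    by eventually_elim (auto simp: a_def intro!: imageI closure_subset[THEN subsetD])
  ultimately have "((\<lambda>t. phi_linv (b t) - phi_linv (a t)) \<longlongrightarrow> 0) at_top"
    using tendsto_diff_continuous_image[OF smooth_map_continuous_on[OF smooth(4)] _ _ lim] by blast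
  then have "((\<lambda>t. norm (phi_linv (b t) - phi_linv (a t))) \<longlongrightarrow> 0) at_top"
    by (rule tendsto_norm_zero)
  \<comment> \<open>The left inverse property turns \<open>phi_linv (a t)\<close> into
    \<open>x t\<close>; the observer output equation gives \<open>xhat t\<close> for
    \<open>t \<ge> 0\<close>.\<close>
  moreover have "\<forall>\<^sub>F t in at_top. norm (phi_linv (b t) - phi_linv (a t)) = norm (xhat t - x t)"
    using eventually_ge_at_top[of 0]
    by eventually_elim (simp add: a_def b_def left_inverse observer_x measurement)
  ultimately show ?thesis
    by (rule Lim_transform_eventually)
qed

end
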